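(* Let $G$ be a connected bipartite graph. (i) If $\delta(G)<\Delta(G)\le 3$, then $\operatorname{reg}(G)\le 2\operatorname{im}(G)$. (ii) If $G$ is $3$-regular, then $\operatorname{reg}(G)\le 2\operatorname{im}(G)+1$.
   Context: $\delta(G),\Delta(G)$ are the minimum and maximum degree. $\operatorname{reg}(G)=\max\{j\ge0:\widetilde H_{j-1}(\operatorname{Ind}(G[S]);\Bbbk)\neq0\text{ for some }S\subseteq V(G)\}$ over a field $\Bbbk$ ($\operatorname{Ind}$ = independence complex). $\operatorname{im}(G)$ is the induced matching number. *)

theory Defs
  imports Main
begin

definition simple_graph :: "'a set \<Rightarrow> 'a set set \<Rightarrow> bool" where
  "simple_graph V E \<longleftrightarrow> finite V \<and> (\<forall>e\<in>E. e \<subseteq> V \<and> card e = 2)"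

definition adj :: "'a set set \<Rightarrow> 'a \<Rightarrow> 'a \<Rightarrow> bool" where
  "adj E u v \<longleftrightarrow> {u, v} \<in> E"

definition connected_graph :: "'a set \<Rightarrow> 'a set set \<Rightarrow> bool" where
  "connected_graph V E \<longleftrightarrow> V \<noteq> {} \<and> (\<forall>u\<in>V. \<forall>v\<in>V. (adj E)\<^sup>*\<^sup>* u v)"

definition bipartite :: "'a set \<Rightarrow> 'a set set \<Rightarrow> bool" where
  "bipartite V E \<longleftrightarrow> (\<exists>A B. A \<union> B = V \<and> A \<inter> B = {} \<and> (\<forall>e\<in>E. card (e \<inter> A) = 1 \<and> card (e \<inter> B) = 1))"

definition degree :: "'a set set \<Rightarrow> 'a \<Rightarrow> nat" where
  "degree E v = card {e \<in> E. v \<in> e}"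

definition min_degree :: "'a set \<Rightarrow> 'a set set \<Rightarrow> nat" where
  "min_degree V E = Min (degree E ` V)"

definition max_degree :: "'a set \<Rightarrow> 'a set set \<Rightarrow> nat" where
  "max_degree V E = Max (degree E ` V)"

definition regular :: "'a set \<Rightarrow> 'a set set \<Rightarrow> nat \<Rightarrow> bool" where
  "regular V E d \<longleftrightarrow> (\<forall>v\<in>V. degree E v = d)"

definition induced_matching :: "'a set set \<Rightarrow> 'a set set \<Rightarrow> bool" where
  "induced_matching E M \<longleftrightarrow> M \<subseteq> E \<and>
     (\<forall>e\<in>M. \<forall>f\<in>M. e \<noteq> f \<longrightarrow> e \<inter> f = {} \<and> \<not> (\<exists>g\<in>E. g \<inter> e \<noteq> {} \<and> g \<inter> f \<noteq> {}))"

definition induced_matching_number :: "'a set set \<Rightarrow> nat" where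
  "induced_matching_number E = Max (card ` {M. induced_matching E M})"

text \<open>Faces of the independence complex of the induced subgraph G[S]: subsets of S
  containing no edge of G. The empty face is always included.\<close>

definition ind_complex :: "'a set set \<Rightarrow> 'a set \<Rightarrow> 'a set set" where
  "ind_complex E S = {F. F \<subseteq> S \<and> (\<forall>e\<in>E. \<not> e \<subseteq> F)}"

text \<open>Simplicial chains with coefficients in a field: functions from sets (faces) to the field.
  A chain is supported on the faces of K of cardinality m (i.e. of dimension m - 1).\<close>

definition chain_on :: "'a set set \<Rightarrow> nat \<Rightarrow> ('a set \<Rightarrow> 'k::field) \<Rightarrow> bool" where
  "chain_on K m c \<longleftrightarrow> (\<forall>F. c F \<noteq> 0 \<longrightarrow> F \<in> K \<and> card F = m)"

definition bd_sign :: "'a::linorder \<Rightarrow> 'a set \<Rightarrow> 'k::field" where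
  "bd_sign v F = (-1) ^ card {u \<in> F. u < v}"

text \<open>Simplicial boundary map of the augmented (reduced) chain complex of K; the empty face
  sits in dimension -1, so the boundary of a vertex is the empty face.\<close>

definition boundary :: "'a::linorder set set \<Rightarrow> ('a set \<Rightarrow> 'k::field) \<Rightarrow> ('a set \<Rightarrow> 'k)" where
  "boundary K c = (\<lambda>T. if T \<in> K then
       (\<Sum>v \<in> \<Union>K - T. if insert v T \<in> K then bd_sign v (insert v T) * c (insert v T) else 0)
     else 0)"

text \<open>Reduced homology in dimension m - 1 is nonzero: there is a cycle supported on faces
  of cardinality m that is not a boundary of a chain on faces of cardinality m + 1.\<close>

definition red_hom_nonzero :: "'k::field itself \<Rightarrow> 'a::linorder set set \<Rightarrow> nat \<Rightarrow> bool" where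
  "red_hom_nonzero _ K m \<longleftrightarrow>
     (\<exists>c :: 'a set \<Rightarrow> 'k. chain_on K m c \<and> boundary K c = (\<lambda>_. 0) \<and>
        \<not> (\<exists>d :: 'a set \<Rightarrow> 'k. chain_on K (Suc m) d \<and> boundary K d = c))"

text \<open>reg(G) = max { j \<ge> 0 : reduced H_{j-1}(Ind(G[S]); k) \<noteq> 0 for some S \<subseteq> V }.\<close>

definition reg :: "'k::field itself \<Rightarrow> 'a::linorder set \<Rightarrow> 'a set set \<Rightarrow> nat" where
  "reg k V E = Max {j. \<exists>S \<subseteq> V. red_hom_nonzero k (ind_complex E S) j}"

end

(* For a simplicial complex and a vertex v, a nonzero homology class survives either in the
  deletion of v or, one degree lower, in the link of v; for independence complexes these are
  Ind(G - v) and Ind(G - N[v]).  Let x be a vertex of degree at most 2 with neighbours c and y.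
  Splitting at c and then at y leaves Ind(G - c) in the same degree, Ind(G - N[c] - y) one degree
  lower, or Ind(G - N[c] - N[y]) two degrees lower.  The last two graphs are contained in
  G - N[xc] and G - N[xy], so an induced matching in them extends by one edge, and induction gives
  reg <= 2 im for every graph all of whose induced subgraphs have a vertex of degree at most 2.
  In a connected subcubic graph every proper induced subgraph has this property; this covers (i),
  and in (ii) a single splitting at an arbitrary vertex reduces to it. *)
theory Submission
  imports Defs
begin

section \<open>Chains, cones and deletion-link splitting\<close>

text \<open>No membership test and a fixed ground set: this operator is linear and is shared by a
  complex, its deletion and its link, so chains of all three can be combined.\<close>

definition bd :: "'a::linorder set \<Rightarrow> ('a set \<Rightarrow> 'k::field) \<Rightarrow> 'a set \<Rightarrow> 'k" where
  "bd U c = (\<lambda>T. \<Sum>w\<in>U - T. bd_sign w (insert w T) * c (insert w T))"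

text \<open>The join of \<open>d\<close> with the apex \<open>v\<close>. The sign cancels the one
  that the boundary gives to the removal of \<open>v\<close>.\<close>

definition cone :: "'a::linorder \<Rightarrow> ('a set \<Rightarrow> 'k::field) \<Rightarrow> 'a set \<Rightarrow> 'k" where
  "cone v d = (\<lambda>F. if v \<in> F then bd_sign v F * d (F - {v}) else 0)"

text \<open>The faces through \<open>v\<close>, moved to the link. The sign is its own inverse, so
  coning with \<open>v\<close> recovers exactly these faces of \<open>c\<close>.\<close>

definition link_part :: "'a::linorder \<Rightarrow> ('a set \<Rightarrow> 'k::field) \<Rightarrow> 'a set \<Rightarrow> 'k" where
  "link_part v c = (\<lambda>T. if v \<in> T then 0 else bd_sign v (insert v T) * c (insert v T))"

definition del_part :: "'a \<Rightarrow> ('a set \<Rightarrow> 'k::field) \<Rightarrow> 'a set \<Rightarrow> 'k" where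
  "del_part v c = (\<lambda>T. if v \<in> T then 0 else c T)"

text \<open>\<open>U\<close> may be larger than the vertex set of \<open>K\<close>; thus deletion
  and link of a vertex keep the same \<open>U\<close>.\<close>

definition simplicial :: "'a set \<Rightarrow> 'a set set \<Rightarrow> bool" where
  "simplicial U K \<longleftrightarrow> finite U \<and> \<Union>K \<subseteq> U \<and> (\<forall>F\<in>K. \<forall>T\<subseteq>F. T \<in> K)"

section \<open>Signs and the boundary over a fixed ground set\<close>

lemma bd_sign_square [simp]: "bd_sign v F * bd_sign v F = (1::'k::field)"
  by (simp add: bd_sign_def flip: power_add mult_2)

lemma bd_sign_square_left [simp]: "bd_sign v F * (bd_sign v F * a) = (a::'k::field)"
  by (simp flip: mult.assoc)

lemma bd_sign_insert:
  assumes "finite F" "w \<notin> F"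
  shows "bd_sign v (insert w F) = (if w < v then - bd_sign v F else (bd_sign v F :: 'k::field))"
proof -
  have "{u \<in> insert w F. u < v} = (if w < v then insert w {u \<in> F. u < v} else {u \<in> F. u < v})"
    by auto
  then show ?thesis using assms by (simp add: bd_sign_def)
qed

lemma bd_add: "bd U (\<lambda>F. c F + d F) = (\<lambda>F. bd U c F + bd U d F)"
  by (simp add: bd_def algebra_simps sum.distrib)

lemma bd_diff: "bd U (\<lambda>F. c F - d F) = (\<lambda>F. bd U c F - bd U d F)"
  by (simp add: bd_def algebra_simps sum_subtractf)

lemma bd_avoids: "(\<And>F. v \<in> F \<Longrightarrow> c F = 0) \<Longrightarrow> v \<in> T \<Longrightarrow> bd U c T = 0"
  by (simp add: bd_def)

text \<open>The chain vanishes off \<open>K\<close>, so the extra summands are zero; and by downward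
  closure a set outside \<open>K\<close> has no superset in \<open>K\<close>, so \<open>bd\<close>
  vanishes there as well.\<close>

lemma boundary_eq_bd:
  assumes "simplicial U K" "chain_on K m c"
  shows "boundary K c = bd U c"
proof
  fix T
  have K: "finite U" "\<Union>K \<subseteq> U" "\<And>F T. F \<in> K \<Longrightarrow> T \<subseteq> F \<Longrightarrow> T \<in> K"
    using assms(1) by (auto simp: simplicial_def)
  have c: "c F = 0" if "F \<notin> K" for F using assms(2) that by (auto simp: chain_on_def)
  show "boundary K c T = bd U c T"
  proof (cases "T \<in> K")
    case True
    have "boundary K c T = (\<Sum>w\<in>\<Union>K - T. bd_sign w (insert w T) * c (insert w T))"
      unfolding boundary_def using True by (auto intro!: sum.cong simp: c)
    also have "\<dots> = bd U c T"
      unfolding bd_def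
    proof (rule sum.mono_neutral_left)
      show "\<forall>w\<in>U - T - (\<Union>K - T). bd_sign w (insert w T) * c (insert w T) = 0"
        by (auto intro!: c)
    qed (use K in auto)
    finally show ?thesis .
  next
    case False
    then have "insert w T \<notin> K" for w using K(3) by blast
    then show ?thesis using False by (simp add: boundary_def bd_def c)
  qed
qed

lemma red_hom_nonzero_iff:
  assumes "simplicial U K"
  shows "red_hom_nonzero TYPE('k::field) K m \<longleftrightarrow>
    (\<exists>c :: 'a::linorder set \<Rightarrow> 'k. chain_on K m c \<and> bd U c = (\<lambda>_. 0) \<and>
       \<not> (\<exists>d. chain_on K (Suc m) d \<and> bd U d = c))"
  unfolding red_hom_nonzero_def using boundary_eq_bd[OF assms] by metis

section \<open>The cone operator and the splitting of a cycle at a vertex\<close>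

lemma cone_link_part: "del_part v c F + cone v (link_part v c) F = c F"
  by (auto simp: cone_def link_part_def del_part_def insert_absorb)

text \<open>Coning is a contracting homotopy. On a set avoiding \<open>v\<close> only the removal of
  \<open>v\<close> contributes and returns \<open>d\<close>; on a set containing \<open>v\<close>,
  removing another vertex anticommutes with coning. Infinite sets carry only zero values.\<close>

lemma bd_cone:
  assumes U: "finite U" "v \<in> U"
    and v: "\<And>F. v \<in> F \<Longrightarrow> d F = 0" and fin: "\<And>F. infinite F \<Longrightarrow> d F = 0"
  shows "bd U (cone v d) = (\<lambda>F. d F - cone v (bd U d) F)"
proof
  fix F
  consider "infinite F" | "finite F" "v \<notin> F" | "finite F" "v \<in> F" by blast
  then show "bd U (cone v d) F = d F - cone v (bd U d) F"
  proof cases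
    case 1
    then have "cone v d (insert w F) = 0" for w by (simp add: cone_def fin)
    moreover have "bd U d (F - {v}) = 0" using 1 by (simp add: bd_def fin)
    ultimately show ?thesis using 1 by (simp add: bd_def[of U "cone v d"] cone_def[of v "bd U d"] fin)
  next
    case 2
    have "bd U (cone v d) F = (\<Sum>w\<in>{v}. bd_sign w (insert w F) * cone v d (insert w F))"
      unfolding bd_def by (rule sum.mono_neutral_right) (use U 2 in \<open>auto simp: cone_def\<close>)
    then show ?thesis using 2 by (simp add: cone_def)
  next
    case 3
    define T where "T = F - {v}"
    have T: "F = insert v T" "v \<notin> T" "finite T" using 3 by (auto simp: T_def)
    \<comment> \<open>Either \<open>w < v\<close> or \<open>v < w\<close>, so exactly one of the two
      signs flips when the other vertex is present; hence the minus sign.\<close>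
    have sgn: "bd_sign w (insert w F) * (bd_sign v (insert w F) * a)
        = - (bd_sign v F * (bd_sign w (insert w T) * a))" if "w \<in> U - F" for w and a :: 'b
    proof -
      have w: "w \<noteq> v" "w \<notin> T" using that T by auto
      have "bd_sign w (insert w F) = (if v < w then - bd_sign w (insert w T) else (bd_sign w (insert w T) :: 'b))"
        using bd_sign_insert[of "insert w T" v w] w T by (simp add: insert_commute)
      moreover have "bd_sign v (insert w F) = (if w < v then - bd_sign v F else (bd_sign v F :: 'b))"
        using bd_sign_insert[of F w v] that 3 by simp
      moreover have "w < v \<longleftrightarrow> \<not> v < w" using w by auto
      ultimately show ?thesis by (simp add: mult.left_commute)
    qed
    have "bd U (cone v d) F
        = (\<Sum>w\<in>U - F. bd_sign w (insert w F) * (bd_sign v (insert w F) * d (insert w T)))"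
      unfolding bd_def
    proof (rule sum.cong)
      fix w assume "w \<in> U - F"
      then have "insert w F - {v} = insert w T" using T by auto
      then show "bd_sign w (insert w F) * cone v d (insert w F) =
          bd_sign w (insert w F) * (bd_sign v (insert w F) * d (insert w T))"
        using 3 by (simp add: cone_def)
    qed simp
    also have "\<dots> = (\<Sum>w\<in>U - F. - (bd_sign v F * (bd_sign w (insert w T) * d (insert w T))))"
      by (rule sum.cong) (simp_all only: sgn)
    also have "\<dots> = - (bd_sign v F * (\<Sum>w\<in>U - F. bd_sign w (insert w T) * d (insert w T)))"
      by (simp add: sum_negf sum_distrib_left)
    \<comment> \<open>The index set \<open>U - T\<close> has the additional element
      \<open>v\<close>, where \<open>d\<close> is zero.\<close>
    also have "(\<Sum>w\<in>U - F. bd_sign w (insert w T) * d (insert w T)) = bd U d T"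
      unfolding bd_def by (rule sum.mono_neutral_left) (use U T in \<open>auto simp: v\<close>)
    finally show ?thesis using 3 v by (simp add: cone_def T_def)
  qed
qed

text \<open>Write \<open>c = e + cone v l\<close> with deletion part \<open>e\<close> and link part
  \<open>l\<close>. Taking boundaries gives \<open>0 = bd e + l - cone v (bd l)\<close>. The first
  two terms live on sets avoiding \<open>v\<close>, the last on sets containing \<open>v\<close>, so
  each group vanishes by itself.\<close>

lemma bd_split:
  fixes c :: "'a::linorder set \<Rightarrow> 'k::field"
  assumes U: "finite U" "v \<in> U" and fin: "\<And>F. infinite F \<Longrightarrow> c F = 0" and cyc: "bd U c = (\<lambda>_. 0)"
  shows "bd U (link_part v c) = (\<lambda>_. 0)" "bd U (del_part v c) = (\<lambda>F. - link_part v c F)"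
proof -
  let ?l = "link_part v c" and ?e = "del_part v c"
  have l: "v \<in> F \<Longrightarrow> ?l F = 0" and e: "v \<in> F \<Longrightarrow> ?e F = 0" for F
    by (simp_all add: link_part_def del_part_def)
  have "infinite F \<Longrightarrow> ?l F = 0" for F by (simp add: link_part_def fin)
  note bd_cone[OF U l this]
  moreover have "bd U (\<lambda>F. ?e F + cone v ?l F) = (\<lambda>_. 0)"
    by (simp add: cone_link_part cyc)
  ultimately have eq: "bd U ?e F + (?l F - cone v (bd U ?l) F) = 0" for F
    by (simp add: bd_add) metis
  show "bd U ?l = (\<lambda>_. 0)"
  proof
    fix T show "bd U ?l T = 0"
    proof (cases "v \<in> T")
      case True
      show ?thesis by (rule bd_avoids[where v = v]) (simp_all add: l True)
    next
      case False
      have "bd_sign v (insert v T) * bd U ?l T = 0"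
        using eq[of "insert v T"] False
        by (simp add: bd_avoids[where v = v] e l cone_def)
      then show ?thesis by (metis bd_sign_square_left mult_zero_right)
    qed
  qed
  then have "cone v (bd U ?l) F = 0" for F by (simp add: cone_def)
  then show "bd U ?e = (\<lambda>F. - ?l F)" using eq by (auto simp: add_eq_0_iff2)
qed

lemma chain_on_infinite: "simplicial U K \<Longrightarrow> chain_on K m c \<Longrightarrow> infinite F \<Longrightarrow> c F = 0"
  unfolding simplicial_def chain_on_def by (meson Sup_le_iff finite_subset)

text \<open>\<open>L\<close> is left open because it is the link in the splitting argument, but the
  deletion when \<open>K\<close> itself is a cone with apex \<open>v\<close>.\<close>

lemma chain_on_cone:
  assumes "simplicial U K" and "\<And>F. F \<in> L \<Longrightarrow> v \<notin> F \<and> insert v F \<in> K" "chain_on L m d"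
  shows "chain_on K (Suc m) (cone v d)"
  unfolding chain_on_def
proof (intro allI impI)
  fix F assume "cone v d F \<noteq> 0"
  then have F: "v \<in> F" "d (F - {v}) \<noteq> 0" by (auto simp: cone_def split: if_splits)
  then have "F - {v} \<in> L" "card (F - {v}) = m" using assms(3) by (auto simp: chain_on_def)
  then have "F \<in> K" using assms(2)[of "F - {v}"] F by (simp add: insert_absorb)
  moreover have "finite F"
    using \<open>F \<in> K\<close> assms(1) by (auto simp: simplicial_def intro: finite_subset)
  ultimately show "F \<in> K \<and> card F = Suc m"
    using F(1) \<open>card (F - {v}) = m\<close> card.remove by metis
qed

lemma chain_on_link_part:
  assumes "simplicial U K" "chain_on K (Suc m) c"
  shows "chain_on {F. v \<notin> F \<and> insert v F \<in> K} m (link_part v c)"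
  unfolding chain_on_def
proof (intro allI impI)
  fix T assume "link_part v c T \<noteq> 0"
  then have T: "v \<notin> T" "c (insert v T) \<noteq> 0" by (auto simp: link_part_def split: if_splits)
  then have "insert v T \<in> K" "card (insert v T) = Suc m" using assms(2) by (auto simp: chain_on_def)
  moreover have "finite (insert v T)"
    using calculation(1) assms(1) by (auto simp: simplicial_def intro: finite_subset)
  ultimately show "T \<in> {F. v \<notin> F \<and> insert v F \<in> K} \<and> card T = m" using T by simp
qed

section \<open>Homology of deletion and link\<close>

lemma simplicial_del_link:
  assumes "simplicial U K"
  shows "simplicial U {F \<in> K. v \<notin> F}" "simplicial U {F. v \<notin> F \<and> insert v F \<in> K}"
proof -
  have K: "finite U" "\<Union>K \<subseteq> U" "\<And>F T. F \<in> K \<Longrightarrow> T \<subseteq> F \<Longrightarrow> T \<in> K"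
    using assms by (auto simp: simplicial_def)
  show "simplicial U {F \<in> K. v \<notin> F}"
    using K unfolding simplicial_def by blast
  have "insert v T \<in> K" if "insert v F \<in> K" "T \<subseteq> F" for F T
    using K(3)[OF that(1)] that(2) by blast
  then show "simplicial U {F. v \<notin> F \<and> insert v F \<in> K}"
    using K(1,2) unfolding simplicial_def by blast
qed

text \<open>A cycle \<open>c\<close> with deletion part \<open>e\<close> and link part
  \<open>l\<close> bounds \<open>cone v e\<close>: the boundary of this cone is
  \<open>e - cone v (bd e) = e + cone v l = c\<close>.\<close>

lemma red_hom_nonzero_cone:
  assumes K: "simplicial U K" and v: "v \<in> U" and cone: "\<And>F. F \<in> K \<Longrightarrow> insert v F \<in> K"
  shows "\<not> red_hom_nonzero TYPE('k::field) K m"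
proof
  assume "red_hom_nonzero TYPE('k) K m"
  then obtain c :: "'a set \<Rightarrow> 'k" where c: "chain_on K m c" "bd U c = (\<lambda>_. 0)"
    and nb: "\<not> (\<exists>d. chain_on K (Suc m) d \<and> bd U d = c)"
    unfolding red_hom_nonzero_iff[OF K] by blast
  have U: "finite U" using K by (simp add: simplicial_def)
  note fin = chain_on_infinite[OF K c(1)]
  have "chain_on {F \<in> K. v \<notin> F} m (del_part v c)"
    using c(1) by (auto simp: chain_on_def del_part_def)
  then have "chain_on K (Suc m) (cone v (del_part v c))"
    by (rule chain_on_cone[OF K, rotated]) (simp add: cone)
  moreover have "bd U (cone v (del_part v c)) = c"
  proof
    fix F
    have "bd U (cone v (del_part v c)) F
        = del_part v c F - cone v (bd U (del_part v c)) F"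
      by (subst bd_cone[OF U v]) (auto simp: del_part_def fin)
    also have "\<dots> = del_part v c F + cone v (link_part v c) F"
      by (simp add: bd_split(2)[OF U v fin c(2)]) (simp add: cone_def)
    finally show "bd U (cone v (del_part v c)) F = c F" by (simp add: cone_link_part)
  qed
  ultimately show False using nb by blast
qed

text \<open>This is exactness at \<open>K\<close> of the long exact sequence of deletion and link.
  If the link part \<open>l\<close> of a cycle \<open>c\<close> with deletion part \<open>e\<close>
  bounds, say \<open>l = bd d\<close>, then \<open>e + d\<close> is a cycle of the deletion and
  differs from \<open>c\<close> by the boundary of \<open>cone v d\<close>. So if
  \<open>e + d = bd f\<close>, then \<open>f - cone v d\<close> would fill \<open>c\<close>.\<close>

lemma red_hom_nonzero_del_or_link:
  assumes K: "simplicial U K" and v: "v \<in> U" and nz: "red_hom_nonzero TYPE('k::field) K m"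
  shows "red_hom_nonzero TYPE('k) {F \<in> K. v \<notin> F} m \<or>
    (\<exists>n. m = Suc n \<and> red_hom_nonzero TYPE('k) {F. v \<notin> F \<and> insert v F \<in> K} n)"
proof (rule disjCI)
  let ?D = "{F \<in> K. v \<notin> F}" and ?L = "{F. v \<notin> F \<and> insert v F \<in> K}"
  note D = simplicial_del_link(1)[OF K, of v] and L = simplicial_del_link(2)[OF K, of v]
  assume link0: "\<not> (\<exists>n. m = Suc n \<and> red_hom_nonzero TYPE('k) ?L n)"
  obtain c :: "'a set \<Rightarrow> 'k" where c: "chain_on K m c" "bd U c = (\<lambda>_. 0)"
    and nb: "\<not> (\<exists>d. chain_on K (Suc m) d \<and> bd U d = c)"
    using nz unfolding red_hom_nonzero_iff[OF K] by blast
  have U: "finite U" using K by (simp add: simplicial_def)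
  note fin = chain_on_infinite[OF K c(1)]
  note split = bd_split[OF U v fin c(2)]
  obtain d :: "'a set \<Rightarrow> 'k" where d: "chain_on ?L m d" "bd U d = link_part v c"
  proof (cases m)
    \<comment> \<open>There is no lower degree here, but a chain on the empty face has link part
      zero, which the zero chain fills.\<close>
    case 0
    have "c (insert v T) = 0" for T
    proof (rule ccontr)
      assume "c (insert v T) \<noteq> 0"
      then have "card (insert v T) = 0" "finite (insert v T)"
        using c(1) fin[of "insert v T"] 0 by (auto simp: chain_on_def)
      then show False by simp
    qed
    then have "link_part v c = (\<lambda>_. 0)" by (auto simp: link_part_def)
    then show ?thesis by (intro that[of "\<lambda>_. 0"]) (auto simp: chain_on_def bd_def)
  next
    case (Suc n)
    then have "\<not> red_hom_nonzero TYPE('k) ?L n" using link0 by blast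
    then show ?thesis
      using chain_on_link_part[OF K c(1)[unfolded Suc]] split(1) that Suc
      unfolding red_hom_nonzero_iff[OF L] by blast
  qed
  have dv: "v \<in> F \<Longrightarrow> d F = 0" for F using d(1) by (auto simp: chain_on_def)
  note bd_cone_d = bd_cone[OF U v dv chain_on_infinite[OF L d(1)]]
  define c' where "c' = (\<lambda>F. del_part v c F + d F)"
  have down: "T \<in> K" if "insert v T \<in> K" for T
    using that K unfolding simplicial_def by (meson subset_insertI)
  have "chain_on ?D m c'"
    unfolding chain_on_def
  proof (intro allI impI)
    fix F assume "c' F \<noteq> 0"
    then have "v \<notin> F" "c F \<noteq> 0 \<or> d F \<noteq> 0"
      using dv[of F] by (auto simp: c'_def del_part_def split: if_splits)
    then show "F \<in> ?D \<and> card F = m"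
      using c(1) d(1) down by (auto simp: chain_on_def)
  qed
  moreover have "bd U c' = (\<lambda>_. 0)"
    by (simp add: c'_def bd_add split d(2))
  moreover have "\<not> (\<exists>f. chain_on ?D (Suc m) f \<and> bd U f = c')"
  proof
    assume "\<exists>f. chain_on ?D (Suc m) f \<and> bd U f = c'"
    then obtain f where f: "chain_on ?D (Suc m) f" "bd U f = c'" by blast
    have "chain_on K (Suc m) (cone v d)"
      by (rule chain_on_cone[OF K _ d(1)]) simp
    then have "chain_on K (Suc m) (\<lambda>F. f F - cone v d F)"
      using f(1) unfolding chain_on_def
      by (metis (no_types, lifting) diff_self mem_Collect_eq)
    moreover have "bd U (\<lambda>F. f F - cone v d F) = c"
    proof
      fix F
      show "bd U (\<lambda>F. f F - cone v d F) F = c F"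
        using cone_link_part[of v c F] by (simp add: bd_diff f(2) bd_cone_d d(2) c'_def)
    qed
    ultimately show False using nb by blast
  qed
  ultimately show "red_hom_nonzero TYPE('k) ?D m"
    unfolding red_hom_nonzero_iff[OF D] by blast
qed

section \<open>Independence complexes\<close>

definition closed_nbh :: "'a set set \<Rightarrow> 'a \<Rightarrow> 'a set" where
  "closed_nbh E v = insert v {w. {v, w} \<in> E}"

lemma simplicial_ind_complex: "finite S \<Longrightarrow> simplicial S (ind_complex E S)"
  unfolding simplicial_def ind_complex_def by blast

lemma other_endpoint: "card e = 2 \<Longrightarrow> v \<in> e \<Longrightarrow> \<exists>w. w \<noteq> v \<and> e = {v, w}"
  by (auto simp: card_2_iff)

text \<open>An edge inside \<open>insert v F\<close> lies in \<open>F\<close> or joins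
  \<open>v\<close> to a neighbour in \<open>F\<close>. This identifies the link of \<open>v\<close>
  with an independence complex.\<close>

lemma insert_in_ind_complex:
  assumes "\<forall>e\<in>E. card e = 2" "v \<in> S" "v \<notin> F"
  shows "insert v F \<in> ind_complex E S \<longleftrightarrow> F \<in> ind_complex E (S - closed_nbh E v)"
proof
  assume "insert v F \<in> ind_complex E S"
  then show "F \<in> ind_complex E (S - closed_nbh E v)"
    using assms(3) by (auto simp: ind_complex_def closed_nbh_def)
next
  assume F: "F \<in> ind_complex E (S - closed_nbh E v)"
  have "\<not> e \<subseteq> insert v F" if "e \<in> E" for e
  proof
    assume sub: "e \<subseteq> insert v F"
    have "\<exists>w\<in>F. e = {v, w}" if "v \<in> e"
      using other_endpoint[of e v] assms(1) sub \<open>e \<in> E\<close> that by blast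
    then show False using F sub that unfolding ind_complex_def closed_nbh_def by blast
  qed
  then show "insert v F \<in> ind_complex E S" using F assms(2) by (auto simp: ind_complex_def)
qed

lemma ind_complex_del_or_nbh:
  assumes E: "\<forall>e\<in>E. card e = 2" and S: "finite S" "v \<in> S"
    and nz: "red_hom_nonzero TYPE('k::field) (ind_complex E S) m"
  shows "red_hom_nonzero TYPE('k) (ind_complex E (S - {v})) m \<or>
    (\<exists>n. m = Suc n \<and> red_hom_nonzero TYPE('k) (ind_complex E (S - closed_nbh E v)) n)"
proof -
  have "{F \<in> ind_complex E S. v \<notin> F} = ind_complex E (S - {v})"
    by (auto simp: ind_complex_def)
  moreover have "v \<notin> F" if "F \<in> ind_complex E (S - closed_nbh E v)" for F
    using that unfolding ind_complex_def closed_nbh_def by blast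
  then have "{F. v \<notin> F \<and> insert v F \<in> ind_complex E S} = ind_complex E (S - closed_nbh E v)"
    using insert_in_ind_complex[OF E S(2)] by blast
  ultimately show ?thesis
    using red_hom_nonzero_del_or_link[OF simplicial_ind_complex[OF S(1)] S(2) nz] by simp
qed

text \<open>A vertex without neighbours in \<open>S\<close> can be added to every independent set,
  so the complex is a cone.\<close>

lemma isolated_imp_red_hom_zero:
  assumes E: "\<forall>e\<in>E. card e = 2" and S: "finite S" "v \<in> S" and iso: "S \<inter> {w. {v, w} \<in> E} = {}"
  shows "\<not> red_hom_nonzero TYPE('k::field) (ind_complex E S) m"
proof (rule red_hom_nonzero_cone[OF simplicial_ind_complex[OF S(1)] S(2)])
  fix F assume F: "F \<in> ind_complex E S"
  show "insert v F \<in> ind_complex E S"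
  proof (cases "v \<in> F")
    case False
    then have "F \<in> ind_complex E (S - closed_nbh E v)"
      using F iso unfolding ind_complex_def closed_nbh_def by blast
    then show ?thesis using insert_in_ind_complex[OF E S(2) False] by simp
  qed (use F in \<open>simp add: insert_absorb\<close>)
qed

lemma ind_complex_empty: "{} \<notin> E \<Longrightarrow> ind_complex E {} = {{}}"
  by (auto simp: ind_complex_def)

text \<open>The complex is the sphere of dimension -1, whose only class has index 0 in the indexing
  by cardinality. It is the base of the induction and makes 0 a candidate for
  \<open>reg\<close>.\<close>

lemma red_hom_nonzero_empty_face: "red_hom_nonzero TYPE('k::field) {{}::'a::linorder set} m \<longleftrightarrow> m = 0"
proof -
  have K: "simplicial {} {{}::'a set}" by (simp add: simplicial_def)
  have "chain_on {{}::'a set} 0 (\<lambda>F. if F = {} then 1 else 0 :: 'k)" by (simp add: chain_on_def)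
  moreover have "(\<lambda>_. 0) \<noteq> (\<lambda>F::'a set. if F = {} then 1 else 0 :: 'k)" by (metis zero_neq_one)
  moreover have "c = (\<lambda>_. 0)" if "chain_on {{}::'a set} m c" "m \<noteq> 0" for c :: "'a set \<Rightarrow> 'k"
    using that by (fastforce simp: chain_on_def)
  moreover have "chain_on {{}::'a set} (Suc m) (\<lambda>_. 0 :: 'k)" by (simp add: chain_on_def)
  moreover have "bd {} c = (\<lambda>_. 0)" for c :: "'a set \<Rightarrow> 'k" by (simp add: bd_def)
  ultimately show ?thesis unfolding red_hom_nonzero_iff[OF K] by metis
qed

section \<open>Induced matchings in 2-degenerate graphs\<close>

text \<open>Inducedness refers to all of \<open>E\<close>. For edges of size two lying in
  \<open>S\<close> this agrees with the induced subgraph, and it makes passing to a larger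
  \<open>S\<close> immediate.\<close>

definition matched_within :: "'a set set \<Rightarrow> 'a set \<Rightarrow> nat \<Rightarrow> bool" where
  "matched_within E S m \<longleftrightarrow> (\<exists>M. induced_matching E M \<and> M \<subseteq> Pow S \<and> m \<le> 2 * card M)"

definition two_degenerate :: "'a set set \<Rightarrow> 'a set \<Rightarrow> bool" where
  "two_degenerate E S \<longleftrightarrow> (\<forall>T\<subseteq>S. T \<noteq> {} \<longrightarrow> (\<exists>x\<in>T. card (T \<inter> {w. {x, w} \<in> E}) \<le> 2))"

lemma matched_within_mono: "matched_within E T m \<Longrightarrow> T \<subseteq> S \<Longrightarrow> n \<le> m \<Longrightarrow> matched_within E S n"
  unfolding matched_within_def by (meson Pow_mono order_trans)

lemma two_degenerate_subset: "two_degenerate E S \<Longrightarrow> T \<subseteq> S \<Longrightarrow> two_degenerate E T"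
  unfolding two_degenerate_def by (meson order_trans)

text \<open>A graph edge meeting both \<open>{x, y}\<close> and an edge of the old matching would
  put a vertex of \<open>T\<close> into one of the closed neighbourhoods that \<open>T\<close>
  avoids.\<close>

lemma matched_within_add_edge:
  assumes E: "\<forall>e\<in>E. card e = 2" and S: "finite S" and e: "{x, y} \<in> E" "x \<in> S" "y \<in> S"
    and m: "matched_within E T m"
    and T: "T \<subseteq> S" "T \<inter> (S \<inter> (closed_nbh E x \<union> closed_nbh E y)) = {}"
  shows "matched_within E S (m + 2)"
proof -
  obtain M where M: "induced_matching E M" "M \<subseteq> Pow T" "m \<le> 2 * card M"
    using m unfolding matched_within_def by blast
  have T_N: "T \<inter> closed_nbh E x = {}" "T \<inter> closed_nbh E y = {}" using T by auto
  have apart: "{x, y} \<inter> f = {} \<and> \<not> (\<exists>g\<in>E. g \<inter> {x, y} \<noteq> {} \<and> g \<inter> f \<noteq> {})" if "f \<in> M" for f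
  proof
    have f: "f \<subseteq> T" using M(2) that by blast
    then show disj: "{x, y} \<inter> f = {}" using T_N by (auto simp: closed_nbh_def)
    show "\<not> (\<exists>g\<in>E. g \<inter> {x, y} \<noteq> {} \<and> g \<inter> f \<noteq> {})"
    proof clarify
      fix g assume g: "g \<in> E" "g \<inter> {x, y} \<noteq> {}" "g \<inter> f \<noteq> {}"
      then obtain u w where uw: "u \<in> {x, y}" "w \<in> f" "u \<in> g" "w \<in> g" by blast
      then have "u \<noteq> w" using disj by blast
      moreover have "card g = 2" using E g(1) by blast
      ultimately have "g = {u, w}" using uw by (auto simp: card_2_iff)
      then have "w \<in> closed_nbh E x \<union> closed_nbh E y"
        using uw(1) g(1) by (auto simp: closed_nbh_def)
      then show False using T_N f uw(2) by blast
    qed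
  qed
  have "induced_matching E (insert {x, y} M)"
    unfolding induced_matching_def
  proof (intro conjI ballI impI)
    show "insert {x, y} M \<subseteq> E" using M(1) e(1) by (simp add: induced_matching_def)
    fix f g assume fg: "f \<in> insert {x, y} M" "g \<in> insert {x, y} M" "f \<noteq> g"
    consider "f \<in> M" "g \<in> M" | "f = {x, y}" "g \<in> M" | "g = {x, y}" "f \<in> M"
      using fg by blast
    then have "f \<inter> g = {} \<and> \<not> (\<exists>h\<in>E. h \<inter> f \<noteq> {} \<and> h \<inter> g \<noteq> {})"
    proof cases
      case 1 then show ?thesis using M(1) fg(3) by (simp add: induced_matching_def)
    next
      case 2 then show ?thesis using apart by blast
    next
      case 3 then show ?thesis using apart by blast
    qed
    then show "f \<inter> g = {}" "\<not> (\<exists>h\<in>E. h \<inter> f \<noteq> {} \<and> h \<inter> g \<noteq> {})" by blast+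
  qed
  moreover have "insert {x, y} M \<subseteq> Pow S" using M(2) T(1) e by auto
  moreover have "card (insert {x, y} M) = Suc (card M)"
  proof -
    have "finite M" using M(2) T(1) S by (meson finite_Pow_iff finite_subset)
    moreover have "{x, y} \<notin> M" using apart by blast
    ultimately show ?thesis by simp
  qed
  ultimately show ?thesis
    unfolding matched_within_def using M(3) by (intro exI[of _ "insert {x, y} M"]) simp
qed

text \<open>Induction along strict inclusion: every branch discards \<open>c\<close>. Each further
  branch loses one or two degrees, and the edge added in return is worth two.\<close>

theorem two_degenerate_matched_within:
  assumes E: "\<forall>e\<in>E. card e = 2" and "finite (S :: 'a::linorder set)" "two_degenerate E S"
    and "red_hom_nonzero TYPE('k::field) (ind_complex E S) m"
  shows "matched_within E S m"
  using assms(2-)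
proof (induction S arbitrary: m rule: finite_psubset_induct)
  case (psubset S)
  have IH: "matched_within E T n"
    if "T \<subset> S" "red_hom_nonzero TYPE('k) (ind_complex E T) n" for T n
    using psubset.IH[of T n] that two_degenerate_subset[OF psubset.prems(1), of T] by blast
  show ?case
  proof (cases "S = {}")
    case True
    have "{} \<notin> E" using E by force
    then have "m = 0"
      using psubset.prems(2) True by (simp add: ind_complex_empty red_hom_nonzero_empty_face)
    then show ?thesis by (auto simp: matched_within_def induced_matching_def)
  next
    case False
    then obtain x where x: "x \<in> S" "card (S \<inter> {w. {x, w} \<in> E}) \<le> 2"
      using psubset.prems(1) unfolding two_degenerate_def by blast
    define N where "N = S \<inter> {w. {x, w} \<in> E}"
    have "N \<noteq> {}"
      using isolated_imp_red_hom_zero[OF E psubset.hyps(1) x(1)] psubset.prems(2) N_def by blast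
    moreover have "finite N" using psubset.hyps(1) by (simp add: N_def)
    \<comment> \<open>\<open>c = y\<close> is allowed and covers a vertex with a single neighbour in
      \<open>S\<close>.\<close>
    ultimately obtain c y where cy: "N = {c, y}"
    proof -
      assume that: "\<And>c y. N = {c, y} \<Longrightarrow> thesis"
      have "card N = 1 \<or> card N = 2"
        using \<open>N \<noteq> {}\<close> \<open>finite N\<close> x(2) card_gt_0_iff[of N] unfolding N_def by linarith
      then show thesis
        using that by (metis card_1_singletonE card_2_iff insert_absorb2)
    qed
    have c: "c \<in> S" "{x, c} \<in> E" and y: "y \<in> S" "{x, y} \<in> E" using cy N_def by auto
    have xN: "z = x \<or> z = c \<or> z = y" if "z \<in> S" "z \<in> closed_nbh E x" for z
      using that cy by (auto simp: N_def closed_nbh_def)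
    have x_nbh: "x \<in> closed_nbh E c" "x \<in> closed_nbh E y" "c \<in> closed_nbh E c" "y \<in> closed_nbh E y"
      using c y by (auto simp: closed_nbh_def insert_commute)
    let ?H = "S - closed_nbh E c"
    \<comment> \<open>One added edge raises \<open>k\<close> to \<open>k + 2\<close>, enough for
      \<open>n = k\<close> (one degree lost) and for \<open>n = Suc k\<close> (two lost).\<close>
    have step: "matched_within E S (Suc n)" if "n \<le> k + 1" "matched_within E T k" "{x, z} \<in> E" "z \<in> S"
      "T \<subseteq> S" "T \<inter> (closed_nbh E x \<union> closed_nbh E z) = {}" for n k T z
    proof (rule matched_within_mono)
      show "matched_within E S (k + 2)"
        using matched_within_add_edge[OF E psubset.hyps(1) that(3) x(1) that(4) that(2) that(5)] that(6)
        by blast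
    qed (use that(1) in auto)
    from ind_complex_del_or_nbh[OF E psubset.hyps(1) c(1) psubset.prems(2)] show ?thesis
    proof (elim disjE exE conjE)
      assume "red_hom_nonzero TYPE('k) (ind_complex E (S - {c})) m"
      then show ?thesis using IH[of "S - {c}" m] c(1) by (auto intro: matched_within_mono)
    next
      fix n assume m: "m = Suc n" and n: "red_hom_nonzero TYPE('k) (ind_complex E ?H) n"
      \<comment> \<open>Within \<open>S\<close> the closed neighbourhood of \<open>x\<close> is
        \<open>{x, c, y}\<close>; \<open>x\<close> and \<open>c\<close> left with the neighbourhood
        of \<open>c\<close>, and \<open>y\<close> is deleted, so the edge \<open>{x, c}\<close> can
        be added.\<close>
      have at_c: "matched_within E S m" if "red_hom_nonzero TYPE('k) (ind_complex E (?H - {y})) n"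
        unfolding m
      proof (rule step[of n n "?H - {y}" c])
        show "matched_within E (?H - {y}) n" using that c(1) x_nbh by (intro IH) auto
        show "(?H - {y}) \<inter> (closed_nbh E x \<union> closed_nbh E c) = {}" using xN x_nbh by auto
      qed (use c in auto)
      show ?thesis
      proof (cases "y \<in> ?H")
        \<comment> \<open>Now \<open>y\<close> equals \<open>c\<close> or is adjacent to it, so
          deleting \<open>y\<close> changes nothing and no second splitting is made.\<close>
        case False
        then show ?thesis using at_c n by simp
      next
        case True
        have "finite ?H" using psubset.hyps(1) by simp
        from ind_complex_del_or_nbh[OF E this True n] show ?thesis
        proof (elim disjE exE conjE)
          fix p assume n: "n = Suc p"
            and p: "red_hom_nonzero TYPE('k) (ind_complex E (?H - closed_nbh E y)) p"
          show ?thesis unfolding m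
          \<comment> \<open>Two degrees are lost, and now all of \<open>{x, c, y}\<close> and the
            neighbours of \<open>y\<close> are gone, so \<open>{x, y}\<close> is the edge to
            add.\<close>
          proof (rule step[of n p "?H - closed_nbh E y" y])
            show "matched_within E (?H - closed_nbh E y) p" using p c(1) x_nbh by (intro IH) auto
            show "(?H - closed_nbh E y) \<inter> (closed_nbh E x \<union> closed_nbh E y) = {}"
              using xN x_nbh by auto
          qed (use y n in auto)
        qed (rule at_c)
      qed
    qed
  qed
qed

section \<open>Connected subcubic graphs\<close>

lemma degree_eq_card_nbh:
  assumes "\<forall>e\<in>E. card e = 2"
  shows "degree E x = card {w. {x, w} \<in> E}"
proof -
  have "bij_betw (\<lambda>w. {x, w}) {w. {x, w} \<in> E} {e \<in> E. x \<in> e}"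
  proof (rule bij_betw_imageI)
    show "inj_on (\<lambda>w. {x, w}) {w. {x, w} \<in> E}" by (auto simp: inj_on_def doubleton_eq_iff)
    have "e \<in> (\<lambda>w. {x, w}) ` {w. {x, w} \<in> E}" if "e \<in> E" "x \<in> e" for e
    proof -
      have "card e = 2" using assms that(1) by blast
      from other_endpoint[OF this that(2)] show ?thesis using that(1) by blast
    qed
    then show "(\<lambda>w. {x, w}) ` {w. {x, w} \<in> E} = {e \<in> E. x \<in> e}" by blast
  qed
  then show ?thesis by (simp add: degree_def bij_betw_same_card)
qed

text \<open>A walk from a vertex of \<open>S\<close> to one outside must leave \<open>S\<close> at
  some step.\<close>

lemma connected_leaving_edge:
  assumes "connected_graph V E" "S \<subseteq> V" "S \<noteq> {}" "S \<noteq> V"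
  obtains u w where "u \<in> S" "w \<notin> S" "{u, w} \<in> E"
proof -
  obtain a b where ab: "a \<in> S" "b \<in> V" "b \<notin> S" using assms by blast
  have "(adj E)\<^sup>*\<^sup>* a b" using assms(1,2) ab by (auto simp: connected_graph_def)
  then have "b \<notin> S \<Longrightarrow> \<exists>u w. u \<in> S \<and> w \<notin> S \<and> {u, w} \<in> E"
    by (induction rule: rtranclp_induct) (use ab in \<open>auto simp: adj_def\<close>)
  then show ?thesis using ab that by blast
qed

text \<open>By connectedness some vertex of \<open>T\<close> has a neighbour outside
  \<open>T\<close>, so at most two of its at most three neighbours remain.\<close>

lemma card_nbh_proper_subset:
  assumes G: "simple_graph V E" "connected_graph V E" and deg: "\<forall>v\<in>V. degree E v \<le> 3"
    and T: "T \<subset> V" "T \<noteq> {}"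
  shows "\<exists>x\<in>T. card (T \<inter> {w. {x, w} \<in> E}) \<le> 2"
proof -
  have E: "\<forall>e\<in>E. card e = 2" using G(1) by (simp add: simple_graph_def)
  obtain u w where uw: "u \<in> T" "w \<notin> T" "{u, w} \<in> E"
    using connected_leaving_edge[OF G(2), of T] T by blast
  have "{w. {u, w} \<in> E} \<subseteq> V" "finite V" using G(1) by (auto simp: simple_graph_def)
  then have "card (T \<inter> {w. {u, w} \<in> E}) < card {w. {u, w} \<in> E}"
    using uw by (intro psubset_card_mono) (auto intro: finite_subset)
  also have "\<dots> \<le> 3" using deg uw(1) T(1) degree_eq_card_nbh[OF E, of u] by (metis psubsetD)
  finally show ?thesis using uw(1) by (intro bexI[of _ u]) auto
qed

section \<open>From induced matchings to the bound on the regularity\<close>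

lemma matched_within_le_induced_matching_number:
  assumes "simple_graph V E" "matched_within E S m"
  shows "m \<le> 2 * induced_matching_number E"
proof -
  obtain M where M: "induced_matching E M" "m \<le> 2 * card M"
    using assms(2) unfolding matched_within_def by blast
  have "finite E"
    using assms(1) by (auto simp: simple_graph_def intro: finite_subset[of E "Pow V"])
  then have "finite {M. induced_matching E M}"
    by (auto simp: induced_matching_def intro: finite_subset[of _ "Pow E"])
  then have "card M \<le> induced_matching_number E"
    unfolding induced_matching_number_def using M(1) by (intro Max_ge) auto
  then show ?thesis using M(2) by simp
qed

text \<open>\<open>Max\<close> is meaningful here: the empty \<open>S\<close> contributes 0, and the
  assumed bound makes the set finite.\<close>

lemma reg_le:
  assumes G: "simple_graph V E"
    and le: "\<And>S m. S \<subseteq> V \<Longrightarrow> red_hom_nonzero TYPE('k::field) (ind_complex E S) m \<Longrightarrow> m \<le> b"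
  shows "reg TYPE('k) (V :: 'a::linorder set) E \<le> b"
proof -
  let ?R = "{j. \<exists>S\<subseteq>V. red_hom_nonzero TYPE('k) (ind_complex E S) j}"
  have "{} \<notin> E" using G by (force simp: simple_graph_def)
  then have "0 \<in> ?R"
    by (auto intro!: exI[of _ "{}"] simp: ind_complex_empty red_hom_nonzero_empty_face)
  moreover have "?R \<subseteq> {..b}" using le by auto
  ultimately show ?thesis
    unfolding reg_def by (subst Max_le_iff) (auto intro: finite_subset)
qed

theorem mainTheorem11:
  fixes V :: "'a::linorder set" and E :: "'a set set"
  assumes "simple_graph V E" and "connected_graph V E" and "bipartite V E"
  shows "(min_degree V E < max_degree V E \<and> max_degree V E \<le> 3 \<longrightarrow>
            reg TYPE('k::field) V E \<le> 2 * induced_matching_number E)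
       \<and> (regular V E 3 \<longrightarrow> reg TYPE('k::field) V E \<le> 2 * induced_matching_number E + 1)"
proof (intro conjI impI)
  note G = assms(1,2)
  have V: "finite V" "V \<noteq> {}" and E: "\<forall>e\<in>E. card e = 2"
    using G by (auto simp: simple_graph_def connected_graph_def)
  note nbh_V = degree_eq_card_nbh[OF E]
  have bound: "m \<le> 2 * induced_matching_number E"
    if "S \<subseteq> V" "two_degenerate E S" "red_hom_nonzero TYPE('k) (ind_complex E S) m" for S m
    using two_degenerate_matched_within[OF E _ that(2,3)] that(1) V(1)
      matched_within_le_induced_matching_number[OF G(1)] finite_subset by blast
  {
    assume "min_degree V E < max_degree V E \<and> max_degree V E \<le> 3"
    then have lt: "min_degree V E \<le> 2" and le: "max_degree V E \<le> 3" by auto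
    have deg: "\<forall>v\<in>V. degree E v \<le> 3"
      using le V by (auto simp: max_degree_def)
    \<comment> \<open>Connectedness settles proper subsets; for \<open>V\<close> itself a vertex
      attaining the minimum degree serves.\<close>
    have "min_degree V E \<in> degree E ` V"
      unfolding min_degree_def using V by (intro Min_in) auto
    then obtain x where "x \<in> V" "degree E x \<le> 2" using lt by auto
    moreover have "V \<inter> {w. {x, w} \<in> E} = {w. {x, w} \<in> E}"
      using G(1) by (auto simp: simple_graph_def)
    ultimately have "\<exists>x\<in>V. card (V \<inter> {w. {x, w} \<in> E}) \<le> 2" using nbh_V by metis
    then have "two_degenerate E V"
      unfolding two_degenerate_def using card_nbh_proper_subset[OF G deg] by blast
    then show "reg TYPE('k) V E \<le> 2 * induced_matching_number E"
      using bound two_degenerate_subset by (intro reg_le[OF G(1)]) blast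
  }
  {
    assume "regular V E 3"
    then have deg: "\<forall>v\<in>V. degree E v \<le> 3" by (simp add: regular_def)
    have proper: "m \<le> 2 * induced_matching_number E"
      if "S \<subset> V" "red_hom_nonzero TYPE('k) (ind_complex E S) m" for S m
    proof (rule bound)
      show "two_degenerate E S"
        unfolding two_degenerate_def using card_nbh_proper_subset[OF G deg] that(1) by blast
    qed (use that in auto)
    obtain v where v: "v \<in> V" using V(2) by blast
    show "reg TYPE('k) V E \<le> 2 * induced_matching_number E + 1"
    proof (rule reg_le[OF G(1)])
      fix S m assume S: "S \<subseteq> V" and nz: "red_hom_nonzero TYPE('k) (ind_complex E S) m"
      show "m \<le> 2 * induced_matching_number E + 1"
      proof (cases "S = V")
        case True
        have sub: "V - {v} \<subset> V" "V - closed_nbh E v \<subset> V" using v by (auto simp: closed_nbh_def)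
        \<comment> \<open>Both resulting vertex sets are proper; the degree lost in the
          neighbourhood branch is the summand 1 of the bound.\<close>
        from ind_complex_del_or_nbh[OF E V(1) v nz[unfolded True]] show ?thesis
          using proper[OF sub(1)] proper[OF sub(2)] by force
      next
        case False
        then have "S \<subset> V" using S by blast
        from proper[OF this nz] show ?thesis by simp
      qed
    qed
  }
qed

end
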